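(* Let $P\in(0,1)^{m\times m}$ be an expected payoff matrix and let $Q$ be a selection matrix. Then the equation $$\operatorname{div}(Q\odot P)=\operatorname{div}\big(Q\odot\sigma(\operatorname{grad}(r))\big)$$ has a unique solution $r\in\{r\in\mathbb{R}^m:\sum_{i=1}^m r_i=0\}$ if and only if $Q$ is a weighted adjacency matrix of a graph on the $m$ players with one strongly connected component.
   Context: There are $m\ge 2$ players. $\sigma:\mathbb{R}\to(0,1)$ is a sigmoid function (typically the logistic function $\sigma(x)=1/(1+e^{-x})$), meaning a continuous strictly increasing bijection with $\sigma(x)+\sigma(-x)=1$ for all $x$. An expected payoff matrix is $P\in\mathbb{R}^{m\times m}$ with entries $P_{ij}\in(0,1)$ and $P_{ij}+P_{ji}=1$ for all $i,j$. A selection matrix is $Q\in[0,1]^{m\times m}$ that is symmetric with $Q_{ii}=0$, $Q_{ij}\ge 0$ and $\sum_{i,j=1}^m Q_{ij}=2$. The graph with weighted adjacency matrix $Q$ has vertex set $\{1,\dots,m\}$ and an edge $\{i,j\}$ iff $Q_{ij}>0$; having one strongly connected component means that this graph on all $m$ vertices is connected. The combinatorial gradient $\operatorname{grad}:\mathbb{R}^m\to\mathbb{R}^{m\times m}$ is $\operatorname{grad}(v)_{ij}=v_i-v_j$. The combinatorial divergence $\operatorname{div}:\mathbb{R}^{m\times m}\to\mathbb{R}^m$ is $\operatorname{div}(A)_i=\frac1m\sum_{j=1}^m A_{ij}$. $\odot$ is the entrywise (Hadamard) product, and $\sigma$ is applied to matrices entrywise. *)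

theory Defs
  imports "HOL-Analysis.Analysis" "Graph_Theory.Digraph_Component"
begin

(* The m players are the elements of a finite index type 'm, so m = CARD('m). *)

definition sigmoid :: "(real \<Rightarrow> real) \<Rightarrow> bool" where
  "sigmoid \<sigma> \<longleftrightarrow>
     continuous_on UNIV \<sigma> \<and> strict_mono \<sigma> \<and> bij_betw \<sigma> UNIV {0<..<1} \<and>
     (\<forall>x. \<sigma> x + \<sigma> (- x) = 1)"

definition payoff_matrix :: "real^'m^'m \<Rightarrow> bool" where
  "payoff_matrix P \<longleftrightarrow>
     (\<forall>i j. P $ i $ j \<in> {0<..<1}) \<and> (\<forall>i j. P $ i $ j + P $ j $ i = 1)"

definition selection_matrix :: "real^'m^'m \<Rightarrow> bool" where
  "selection_matrix Q \<longleftrightarrow>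
     (\<forall>i j. Q $ i $ j \<in> {0..1}) \<and> transpose Q = Q \<and> (\<forall>i. Q $ i $ i = 0) \<and>
     (\<Sum>i\<in>UNIV. \<Sum>j\<in>UNIV. Q $ i $ j) = 2"

(* An undirected edge {i,j} is represented by the two opposite arcs (i,j) and (j,i);
   for symmetric Q both or neither are present.  All players are vertices, including
   those that are never selected. *)
definition weighted_graph :: "real^'m^'m \<Rightarrow> 'm pair_pre_digraph" where
  "weighted_graph Q = \<lparr> pverts = UNIV, parcs = {(i, j). Q $ i $ j > 0} \<rparr>"

(* The qualified name selects graph connectedness rather than the topological notion. *)
definition one_connected_component :: "real^'m^'m \<Rightarrow> bool" where
  "one_connected_component Q \<longleftrightarrow> Digraph_Component.connected (with_proj (weighted_graph Q))"

definition comb_grad :: "real^'m \<Rightarrow> real^'m^'m" where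
  "comb_grad v = (\<chi> i j. v $ i - v $ j)"

definition comb_div :: "real^'m^'m \<Rightarrow> real^'m" where
  "comb_div A = (\<chi> i. (1 / real CARD('m)) * (\<Sum>j\<in>UNIV. A $ i $ j))"

definition map_matrix_entries :: "(real \<Rightarrow> real) \<Rightarrow> real^'m^'m \<Rightarrow> real^'m^'m" where
  "map_matrix_entries f A = (\<chi> i j. f (A $ i $ j))"

(* Multiplication on the type vec is componentwise, so on matrices it is the entrywise
   product rather than the matrix product. *)
abbreviation hadamard :: "real^'m^'m \<Rightarrow> real^'m^'m \<Rightarrow> real^'m^'m" (infixl "\<odot>" 70) where
  "A \<odot> B \<equiv> A * B"

end

theory Submission
  imports Defs
begin

text \<open>
  Write \<open>\<Phi> r = div (Q \<odot> (\<sigma> (grad r) - P))\<close>; the equation says \<open>\<Phi> r = 0\<close>.  Since \<open>Q\<close> is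
  symmetric and both \<open>P\<close> and \<open>\<sigma> (grad r)\<close> add up to \<open>1\<close> with their transposes, the matrix under
  the divergence is antisymmetric.  On antisymmetric matrices the divergence is, up to the
  factor \<open>1 / (2 m)\<close>, the adjoint of the gradient (\<open>inner_comb_div\<close>), so that
  \<open>\<Phi> r \<bullet> x = (1 / (2 m)) \<Sum>\<^sub>i\<^sub>j Q\<^sub>i\<^sub>j (\<sigma> (r\<^sub>i - r\<^sub>j) - P\<^sub>i\<^sub>j) (x\<^sub>i - x\<^sub>j)\<close>.
  Every claim is read off from this identity.

  Testing with \<open>x = 1\<close> shows that \<open>\<Phi>\<close> takes values in the hyperplane \<open>V\<close> of vectors with sum
  zero.  Testing the difference of two solutions against itself shows, as \<open>\<sigma>\<close> is strictly
  increasing, that it is constant along edges; for a connected graph it is therefore constant,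
  and zero if it lies in \<open>V\<close>.  This is uniqueness.

  For existence, each \<open>P\<^sub>i\<^sub>j\<close> lies strictly between the limits \<open>0\<close> and \<open>1\<close> of \<open>\<sigma>\<close>, so
  \<open>(\<sigma> t - P\<^sub>i\<^sub>j) t\<close> grows at least linearly in \<open>\<bar>t\<bar>\<close> (\<open>sigmoid_coercive\<close>).  On \<open>V\<close> the edge
  variation of a connected graph is a norm (\<open>edge_variation_bounds_norm\<close>), so \<open>\<Phi> r \<bullet> r \<ge> 0\<close> on a
  large sphere in \<open>V\<close>, and Brouwer's theorem gives a zero of \<open>\<Phi>\<close> (\<open>coercive_field_has_zero\<close>).

  If the graph is disconnected, some nonconstant vector is constant along edges.  Adding its
  projection to \<open>V\<close> to a solution gives another solution, so uniqueness fails.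
\<close>

section \<open>Connectedness and functions that are constant along edges\<close>

text \<open>
  The indicator of the set of vertices reachable from \<open>i\<close> is constant along edges, so testing
  with real vectors detects all components.
\<close>

lemma one_connected_component_iff:
  fixes Q :: "real^'m^'m"
  shows "one_connected_component Q \<longleftrightarrow>
    (\<forall>x::real^'m. (\<forall>i j. Q $ i $ j > 0 \<longrightarrow> x $ i = x $ j) \<longrightarrow> (\<forall>i j. x $ i = x $ j))"
proof -
  define H where "H = mk_symmetric (with_proj (weighted_graph Q))"
  have verts: "pverts H = UNIV"
    by (simp add: H_def weighted_graph_def)
  have arcs: "(i, j) \<in> parcs H \<longleftrightarrow> Q $ i $ j > 0 \<or> Q $ j $ i > 0" for i j
    by (auto simp: H_def parcs_mk_symmetric weighted_graph_def)
  have conn: "one_connected_component Q \<longleftrightarrow> (\<forall>i j. (i, j) \<in> rtrancl_on UNIV (parcs H))"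
    unfolding one_connected_component_def Digraph_Component.connected_def
      strongly_connected_def reachable_def H_def[symmetric]
    by (auto simp: verts)
  show ?thesis
    unfolding conn
  proof (intro iffI allI impI)
    fix x :: "real^'m" and i j
    assume reach: "\<forall>i j. (i, j) \<in> rtrancl_on UNIV (parcs H)"
      and x: "\<forall>i j. Q $ i $ j > 0 \<longrightarrow> x $ i = x $ j"
    from reach have "(i, j) \<in> rtrancl_on UNIV (parcs H)"
      by blast
    then show "x $ i = x $ j"
    proof (induction rule: rtrancl_on_induct)
      case (step y z)
      then show ?case
        using x arcs[of y z] by metis
    qed simp
  next
    fix i j
    assume *: "\<forall>x::real^'m. (\<forall>i j. Q $ i $ j > 0 \<longrightarrow> x $ i = x $ j) \<longrightarrow> (\<forall>i j. x $ i = x $ j)"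
    define x :: "real^'m"
      where "x = (\<chi> k. if (i, k) \<in> rtrancl_on UNIV (parcs H) then 1 else 0)"
    have "x $ k = x $ l" if "Q $ k $ l > 0" for k l
    proof -
      have "(k, l) \<in> parcs H" "(l, k) \<in> parcs H"
        using that arcs by auto
      then have "(i, k) \<in> rtrancl_on UNIV (parcs H) \<longleftrightarrow> (i, l) \<in> rtrancl_on UNIV (parcs H)"
        by (meson UNIV_I rtrancl_on_into_rtrancl_on)
      then show ?thesis
        by (simp add: x_def)
    qed
    with * have "x $ i = x $ j"
      by blast
    then show "(i, j) \<in> rtrancl_on UNIV (parcs H)"
      by (simp add: x_def split: if_splits)
  qed
qed

lemma constant_sum_zero_imp_zero:
  fixes x :: "real^'m"
  assumes const: "\<And>i j. x $ i = x $ j" and sum: "(\<Sum>i\<in>UNIV. x $ i) = 0"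
  shows "x = 0"
proof -
  have "x $ i = 0" for i
  proof -
    have "(\<Sum>j\<in>UNIV. x $ j) = (\<Sum>j\<in>(UNIV::'m set). x $ i)"
      by (rule sum.cong[OF refl]) (rule const)
    then show ?thesis
      using sum by simp
  qed
  then show ?thesis
    by (simp add: vec_eq_iff)
qed

lemma double_sum_nonneg_zero:
  fixes f :: "'a::finite \<Rightarrow> 'b::finite \<Rightarrow> real"
  assumes nonneg: "\<And>i j. 0 \<le> f i j" and zero: "(\<Sum>i\<in>UNIV. \<Sum>j\<in>UNIV. f i j) = 0"
  shows "f i j = 0"
proof -
  have "(\<Sum>j\<in>UNIV. f i j) = 0"
    using zero nonneg by (simp add: sum_nonneg_eq_0_iff sum_nonneg)
  then show ?thesis
    using nonneg by (simp add: sum_nonneg_eq_0_iff)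
qed

text \<open>
  For a connected graph the right-hand side vanishes on no unit vector with sum zero, hence is
  bounded below on the compact set of such vectors; homogeneity does the rest.
\<close>

lemma edge_variation_bounds_norm:
  fixes W :: "real^'m^'m"
  assumes nonneg: "\<And>i j. 0 \<le> W $ i $ j" and conn: "one_connected_component W"
  obtains c where "c > 0"
    and "\<And>x :: real^'m. (\<Sum>i\<in>UNIV. x $ i) = 0 \<Longrightarrow>
           c * norm x \<le> (\<Sum>i\<in>UNIV. \<Sum>j\<in>UNIV. W $ i $ j * \<bar>x $ i - x $ j\<bar>)"
proof -
  define N where "N x = (\<Sum>i\<in>UNIV. \<Sum>j\<in>UNIV. W $ i $ j * \<bar>x $ i - x $ j\<bar>)" for x :: "real^'m"
  define S where "S = {x :: real^'m. (\<Sum>i\<in>UNIV. x $ i) = 0} \<inter> sphere 0 1"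
  have "compact S"
    unfolding S_def
    by (intro closed_Int_compact closed_Collect_eq continuous_intros compact_sphere)
  have cont: "continuous_on S N"
    unfolding N_def by (intro continuous_intros)
  have pos: "N x > 0" if "x \<in> S" for x
  proof (rule ccontr)
    assume "\<not> N x > 0"
    moreover have "N x \<ge> 0"
      unfolding N_def by (intro sum_nonneg mult_nonneg_nonneg nonneg) auto
    ultimately have "N x = 0"
      by simp
    then have zero: "W $ i $ j * \<bar>x $ i - x $ j\<bar> = 0" for i j
      unfolding N_def by (rule double_sum_nonneg_zero[rotated]) (simp add: nonneg)
    have "\<forall>i j. W $ i $ j > 0 \<longrightarrow> x $ i = x $ j"
    proof (intro allI impI)
      fix i j
      assume "W $ i $ j > 0"
      then show "x $ i = x $ j"
        using zero[of i j] by simp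
    qed
    with conn have const: "x $ i = x $ j" for i j
      unfolding one_connected_component_iff by blast
    have "x = 0"
      using that by (intro constant_sum_zero_imp_zero[OF const]) (simp add: S_def)
    then show False
      using that by (simp add: S_def)
  qed
  obtain c where c: "c > 0" "\<And>x. x \<in> S \<Longrightarrow> c \<le> N x"
  proof (cases "S = {}")
    case True
    then show thesis
      by (intro that[of 1]) auto
  next
    case False
    then obtain u where "u \<in> S" "\<forall>x\<in>S. N u \<le> N x"
      using continuous_attains_inf[OF \<open>compact S\<close> _ cont] by blast
    then show thesis
      by (intro that[of "N u"]) (auto simp: pos)
  qed
  have "c * norm x \<le> N x" if x: "(\<Sum>i\<in>UNIV. x $ i) = 0" for x
  proof (cases "x = 0")
    case True
    then show ?thesis
      by (simp add: N_def)
  next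
    case False
    define u where "u = (1 / norm x) *\<^sub>R x"
    have scale: "x = norm x *\<^sub>R u"
      using False by (simp add: u_def)
    have "u \<in> S"
      using False x by (simp add: S_def u_def sum_divide_distrib[symmetric])
    then have "c \<le> N u"
      by (rule c)
    moreover have "N x = norm x * N u"
    proof -
      have "N (norm x *\<^sub>R u) = norm x * N u"
        unfolding N_def
        by (simp add: sum_distrib_left right_diff_distrib[symmetric] abs_mult mult.left_commute)
      then show ?thesis
        using scale by simp
    qed
    ultimately show ?thesis
      using mult_right_mono[of c "N u" "norm x"] by (simp add: mult.commute)
  qed
  with c(1) show thesis
    using that unfolding N_def by blast
qed

section \<open>Divergence as the adjoint of the gradient\<close>

lemma comb_div_zero [simp]: "comb_div 0 = 0"
  by (simp add: comb_div_def vec_eq_iff)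

lemma comb_div_diff: "comb_div (A - B) = comb_div A - comb_div B"
  by (simp add: comb_div_def vec_eq_iff sum_subtractf right_diff_distrib)

text \<open>
  Summation by parts: antisymmetry makes the terms for \<open>(i, j)\<close> and \<open>(j, i)\<close> of the right-hand
  side contribute the same, whence the factor \<open>2\<close>.
\<close>

lemma inner_comb_div:
  fixes A :: "real^'m^'m"
  assumes "transpose A = - A"
  shows "comb_div A \<bullet> x = (A \<bullet> comb_grad x) / (2 * real CARD('m))"
proof -
  have anti: "A $ j $ i = - A $ i $ j" for i j
    using arg_cong[OF assms, of "\<lambda>B. B $ i $ j"] by (simp add: transpose_def)
  have "(\<Sum>i\<in>UNIV. \<Sum>j\<in>UNIV. A $ i $ j * x $ j) = (\<Sum>j\<in>UNIV. \<Sum>i\<in>UNIV. A $ i $ j * x $ j)"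
    by (rule sum.swap)
  also have "\<dots> = (\<Sum>i\<in>UNIV. \<Sum>j\<in>UNIV. - (A $ i $ j * x $ i))"
    by (intro sum.cong refl) (metis anti mult_minus_left)
  finally have "A \<bullet> comb_grad x = 2 * (\<Sum>i\<in>UNIV. \<Sum>j\<in>UNIV. A $ i $ j * x $ i)"
    by (simp add: inner_vec_def comb_grad_def right_diff_distrib sum_subtractf sum_negf)
  moreover have "comb_div A \<bullet> x = (\<Sum>i\<in>UNIV. \<Sum>j\<in>UNIV. A $ i $ j * x $ i) / real CARD('m)"
    by (simp add: inner_vec_def comb_div_def sum_distrib_right sum_divide_distrib)
  ultimately show ?thesis
    by simp
qed

lemma sum_comb_div_antisymmetric:
  fixes A :: "real^'m^'m"
  assumes "transpose A = - A"
  shows "(\<Sum>i\<in>UNIV. comb_div A $ i) = 0"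
proof -
  have "(\<Sum>i\<in>UNIV. comb_div A $ i) = comb_div A \<bullet> 1"
    by (simp add: inner_vec_def)
  also have "comb_grad (1 :: real^'m) = 0"
    by (simp add: comb_grad_def vec_eq_iff)
  then have "comb_div A \<bullet> 1 = 0"
    by (simp add: inner_comb_div[OF assms])
  finally show ?thesis .
qed

section \<open>Coercivity and zeros of vector fields\<close>

text \<open>
  Outside a bounded interval \<open>\<sigma>\<close> has already crossed \<open>p / 2\<close>, respectively \<open>(1 + p) / 2\<close>, so
  \<open>\<sigma> x - p\<close> has the sign of \<open>x\<close> and stays away from \<open>0\<close>.  The constant \<open>C\<close> absorbs the interval.
\<close>

lemma sigmoid_coercive:
  assumes "sigmoid \<sigma>" and p: "0 < p" "p < 1"
  shows "\<exists>a C. a > 0 \<and> (\<forall>x. a * \<bar>x\<bar> - C \<le> (\<sigma> x - p) * x)"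
proof -
  have mono: "\<sigma> x \<le> \<sigma> y" if "x \<le> y" for x y
    using assms(1) that by (simp add: sigmoid_def strict_mono_less_eq)
  have range: "range \<sigma> = {0<..<1}"
    using assms(1) by (simp add: sigmoid_def bij_betw_def)
  have "p / 2 \<in> range \<sigma>" "(1 + p) / 2 \<in> range \<sigma>"
    using p by (auto simp: range)
  then obtain y z where y: "\<sigma> y = p / 2" and z: "\<sigma> z = (1 + p) / 2"
    by (metis imageE)
  have bounds: "0 < \<sigma> x" "\<sigma> x < 1" for x
    using rangeI[of \<sigma> x] unfolding range by simp_all
  define a where "a = min (p / 2) ((1 - p) / 2)"
  define K where "K = max \<bar>y\<bar> \<bar>z\<bar>"
  have "K \<ge> 0"
    by (simp add: K_def)
  have "a * \<bar>x\<bar> - 2 * K \<le> (\<sigma> x - p) * x" for x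
  proof -
    consider "x \<ge> K" | "x \<le> - K" | "\<bar>x\<bar> < K"
      by linarith
    then show ?thesis
    proof cases
      case 1
      then have "z \<le> x" "x \<ge> 0"
        by (auto simp: K_def)
      then have "(1 - p) / 2 \<le> \<sigma> x - p"
        using mono[of z x] z by (simp add: field_simps)
      then have "a \<le> \<sigma> x - p"
        by (simp add: a_def min.coboundedI2)
      then have "a * x \<le> (\<sigma> x - p) * x"
        using \<open>x \<ge> 0\<close> by (rule mult_right_mono)
      then show ?thesis
        using \<open>x \<ge> 0\<close> \<open>K \<ge> 0\<close> by simp
    next
      case 2
      then have "x \<le> y" "x \<le> 0"
        by (auto simp: K_def)
      then have "p / 2 \<le> p - \<sigma> x"
        using mono[of x y] y by simp
      then have "a \<le> p - \<sigma> x"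
        by (simp add: a_def min.coboundedI1)
      then have "a * - x \<le> (p - \<sigma> x) * - x"
        using \<open>x \<le> 0\<close> by (intro mult_right_mono) auto
      then show ?thesis
        using \<open>x \<le> 0\<close> \<open>K \<ge> 0\<close> by (simp add: algebra_simps)
    next
      case 3
      have "\<bar>\<sigma> x - p\<bar> \<le> 1"
        using bounds[of x] p by (simp add: abs_le_iff)
      then have "\<bar>(\<sigma> x - p) * x\<bar> \<le> 1 * \<bar>x\<bar>"
        unfolding abs_mult by (intro mult_right_mono) auto
      moreover have "a * \<bar>x\<bar> \<le> 1 * \<bar>x\<bar>"
        using p by (intro mult_right_mono) (auto simp: a_def)
      ultimately show ?thesis
        using 3 by linarith
    qed
  qed
  moreover have "a > 0"
    using p by (simp add: a_def)
  ultimately show ?thesis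
    by blast
qed

text \<open>
  If \<open>\<Phi>\<close> had no zero in the ball, \<open>x \<mapsto> - R \<Phi> x / \<parallel>\<Phi> x\<parallel>\<close> would map the ball to its boundary
  sphere, and at a Brouwer fixed point \<open>\<Phi> x\<close> would point strictly inwards.
\<close>

lemma coercive_field_has_zero:
  fixes \<Phi> :: "'a::euclidean_space \<Rightarrow> 'a"
  assumes V: "subspace V" and cont: "continuous_on V \<Phi>" and into: "\<And>x. x \<in> V \<Longrightarrow> \<Phi> x \<in> V"
    and "R > 0" and outward: "\<And>x. x \<in> V \<Longrightarrow> norm x = R \<Longrightarrow> \<Phi> x \<bullet> x \<ge> 0"
  shows "\<exists>x\<in>V. \<Phi> x = 0"
proof (rule ccontr)
  assume "\<not> ?thesis"
  then have nonzero: "\<Phi> x \<noteq> 0" if "x \<in> V" for x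
    using that by blast
  define S where "S = V \<inter> cball 0 R"
  define f where "f x = (- R / norm (\<Phi> x)) *\<^sub>R \<Phi> x" for x
  have norm_f: "norm (f x) = R" if "x \<in> V" for x
    using nonzero[OF that] \<open>R > 0\<close> by (simp add: f_def)
  have "compact S" "convex S"
    unfolding S_def using V
    by (auto intro: closed_Int_compact closed_subspace convex_Int subspace_imp_convex)
  moreover have "S \<noteq> {}"
    using subspace_0[OF V] \<open>R > 0\<close> by (auto simp: S_def)
  moreover have "continuous_on S f"
    unfolding f_def
    by (intro continuous_intros continuous_on_subset[OF cont]) (auto simp: S_def nonzero)
  moreover have "f \<in> S \<rightarrow> S"
  proof
    fix x
    assume "x \<in> S"
    then have "x \<in> V"
      by (simp add: S_def)
    then have "f x \<in> V"
      unfolding f_def by (intro subspace_scale[OF V] into)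
    then show "f x \<in> S"
      using norm_f[OF \<open>x \<in> V\<close>] by (simp add: S_def)
  qed
  ultimately obtain x where x: "x \<in> S" "f x = x"
    using brouwer by blast
  then have "x \<in> V"
    by (simp add: S_def)
  with x norm_f have "norm x = R"
    by metis
  have "\<Phi> x \<bullet> x = \<Phi> x \<bullet> f x"
    using x by simp
  also have "\<dots> = - R * norm (\<Phi> x)"
    using nonzero[OF \<open>x \<in> V\<close>]
    by (simp add: f_def dot_square_norm power2_eq_square)
  also have "\<dots> < 0"
    using nonzero[OF \<open>x \<in> V\<close>] \<open>R > 0\<close> by simp
  finally show False
    using outward[OF \<open>x \<in> V\<close> \<open>norm x = R\<close>] by simp
qed

section \<open>The equation for the ratings\<close>

definition residual :: "(real \<Rightarrow> real) \<Rightarrow> real^'m^'m \<Rightarrow> real^'m^'m \<Rightarrow> real^'m \<Rightarrow> real^'m^'m" where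
  "residual \<sigma> P Q r = Q \<odot> (map_matrix_entries \<sigma> (comb_grad r) - P)"

lemma residual_nth: "residual \<sigma> P Q r $ i $ j = Q $ i $ j * (\<sigma> (r $ i - r $ j) - P $ i $ j)"
  by (simp add: residual_def map_matrix_entries_def comb_grad_def)

lemma equation_iff_residual:
  "comb_div (Q \<odot> P) = comb_div (Q \<odot> map_matrix_entries \<sigma> (comb_grad r)) \<longleftrightarrow>
     comb_div (residual \<sigma> P Q r) = 0"
  unfolding residual_def right_diff_distrib comb_div_diff right_minus_eq by (rule eq_commute)

lemma transpose_residual:
  fixes P Q :: "real^'m^'m"
  assumes "sigmoid \<sigma>" "payoff_matrix P" "selection_matrix Q"
  shows "transpose (residual \<sigma> P Q r) = - residual \<sigma> P Q r"
proof -
  have "transpose (residual \<sigma> P Q r) $ i $ j = (- residual \<sigma> P Q r) $ i $ j" for i j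
  proof -
    have "transpose Q = Q"
      using assms(3) by (simp add: selection_matrix_def)
    from arg_cong[OF this, of "\<lambda>B. B $ i $ j"] have "Q $ j $ i = Q $ i $ j"
      by (simp add: transpose_def)
    have "P $ j $ i = 1 - P $ i $ j"
      using assms(2) by (simp add: payoff_matrix_def eq_diff_eq)
    moreover have "\<sigma> (r $ j - r $ i) = 1 - \<sigma> (r $ i - r $ j)"
      using assms(1) unfolding sigmoid_def by (metis add_diff_cancel_left' minus_diff_eq)
    ultimately have "\<sigma> (r $ j - r $ i) - P $ j $ i = - (\<sigma> (r $ i - r $ j) - P $ i $ j)"
      by linarith
    with \<open>Q $ j $ i = Q $ i $ j\<close> show ?thesis
      by (simp only: residual_nth mult_minus_right transpose_def vec_lambda_beta
          vector_uminus_component)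
  qed
  then show ?thesis
    by (simp only: vec_eq_iff simp_thms)
qed

text \<open>
  All terms of \<open>(residual r - residual s) \<bullet> grad (r - s)\<close> are nonnegative because \<open>\<sigma>\<close> is
  increasing, and for two solutions they add up to zero by summation by parts, so each of them
  vanishes.  On an edge the weight is positive, and strictness of \<open>\<sigma>\<close> forces
  \<open>r\<^sub>i - r\<^sub>j = s\<^sub>i - s\<^sub>j\<close>.
\<close>

lemma solutions_differ_by_locally_constant:
  fixes P Q :: "real^'m^'m"
  assumes "sigmoid \<sigma>" "payoff_matrix P" "selection_matrix Q"
    and r: "comb_div (residual \<sigma> P Q r) = 0" and s: "comb_div (residual \<sigma> P Q s) = 0"
    and edge: "Q $ i $ j > 0"
  shows "(r - s) $ i = (r - s) $ j"
proof -
  define t where "t i j = Q $ i $ j * ((\<sigma> (r $ i - r $ j) - \<sigma> (s $ i - s $ j)) *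
    ((r $ i - r $ j) - (s $ i - s $ j)))" for i j
  have mono: "strict_mono \<sigma>"
    using assms(1) by (simp add: sigmoid_def)
  have prod_pos: "(\<sigma> x - \<sigma> y) * (x - y) > 0" if "x \<noteq> y" for x y
    using that strict_mono_less[OF mono, of x y] strict_mono_less[OF mono, of y x]
    by (auto simp: zero_less_mult_iff neq_iff)
  have t_nonneg: "t i j \<ge> 0" for i j
  proof -
    have "(\<sigma> x - \<sigma> y) * (x - y) \<ge> 0" for x y
      using prod_pos[of x y] by (cases "x = y") auto
    moreover have "Q $ i $ j \<ge> 0"
      using assms(3) by (simp add: selection_matrix_def)
    ultimately show ?thesis
      unfolding t_def by (simp only: mult_nonneg_nonneg)
  qed
  have "residual \<sigma> P Q q \<bullet> comb_grad (r - s) = 0" if "comb_div (residual \<sigma> P Q q) = 0" for q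
    using inner_comb_div[OF transpose_residual[OF assms(1-3)], of q "r - s"] that by simp
  then have "(residual \<sigma> P Q r - residual \<sigma> P Q s) \<bullet> comb_grad (r - s) = 0"
    using r s by (simp add: inner_diff_left)
  also have "(residual \<sigma> P Q r - residual \<sigma> P Q s) \<bullet> comb_grad (r - s) =
      (\<Sum>i\<in>UNIV. \<Sum>j\<in>UNIV. t i j)"
    by (simp add: inner_vec_def residual_nth comb_grad_def t_def algebra_simps)
  finally have "t i j = 0"
    by (rule double_sum_nonneg_zero[OF t_nonneg])
  then have "(\<sigma> (r $ i - r $ j) - \<sigma> (s $ i - s $ j)) *
      ((r $ i - r $ j) - (s $ i - s $ j)) = 0"
    using edge by (simp only: t_def mult_eq_0_iff) simp
  then have "r $ i - r $ j = s $ i - s $ j"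
    using prod_pos by (metis less_irrefl)
  then show ?thesis
    by simp
qed

text \<open>
  Summing the scalar coercivity bounds over all pairs gives
  \<open>2 m (\<Phi> r \<bullet> r) \<ge> c \<parallel>r\<parallel> - B\<close> on the hyperplane, so that \<open>\<Phi>\<close> points outwards on large spheres.
\<close>

lemma solution_exists:
  fixes P Q :: "real^'m^'m"
  assumes "sigmoid \<sigma>" "payoff_matrix P" "selection_matrix Q" "one_connected_component Q"
  shows "\<exists>r :: real^'m. (\<Sum>i\<in>UNIV. r $ i) = 0 \<and> comb_div (residual \<sigma> P Q r) = 0"
proof -
  define \<Phi> where "\<Phi> r = comb_div (residual \<sigma> P Q r)" for r
  define V where "V = {r :: real^'m. (\<Sum>i\<in>UNIV. r $ i) = 0}"
  have nonneg: "Q $ i $ j \<ge> 0" for i j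
    using assms(3) by (simp add: selection_matrix_def)
  have "\<forall>i j. \<exists>a C. a > 0 \<and> (\<forall>x. a * \<bar>x\<bar> - C \<le> (\<sigma> x - P $ i $ j) * x)"
    using assms(2) by (intro allI sigmoid_coercive assms(1)) (simp_all add: payoff_matrix_def)
  then obtain a C where "\<forall>i j. a i j > 0 \<and>
      (\<forall>x. a i j * \<bar>x\<bar> - C i j \<le> (\<sigma> x - P $ i $ j) * x)"
    unfolding choice_iff by (elim exE)
  then have a: "a i j > 0" and aC: "a i j * \<bar>x\<bar> - C i j \<le> (\<sigma> x - P $ i $ j) * x" for i j x
    by simp_all
  \<comment> \<open>The slopes \<open>a\<close> are positive, so absorbing them into the weights keeps the graph.\<close>
  define W :: "real^'m^'m" where "W = (\<chi> i j. Q $ i $ j * a i j)"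
  have W_pos: "W $ i $ j > 0 \<longleftrightarrow> Q $ i $ j > 0" for i j
    using a[of i j] by (simp add: W_def zero_less_mult_iff less_asym)
  have W_nonneg: "W $ i $ j \<ge> 0" for i j
    using a[of i j] nonneg[of i j] by (simp add: W_def)
  have "one_connected_component W"
    using assms(4) by (simp add: one_connected_component_iff W_pos)
  with W_nonneg obtain c where "c > 0"
    and c: "\<And>x :: real^'m. (\<Sum>i\<in>UNIV. x $ i) = 0 \<Longrightarrow>
             c * norm x \<le> (\<Sum>i\<in>UNIV. \<Sum>j\<in>UNIV. W $ i $ j * \<bar>x $ i - x $ j\<bar>)"
    using edge_variation_bounds_norm by blast
  define B where "B = (\<Sum>i\<in>UNIV. \<Sum>j\<in>UNIV. Q $ i $ j * C i j)"
  have lower: "c * norm r - B \<le> 2 * real CARD('m) * (\<Phi> r \<bullet> r)" if "r \<in> V" for r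
  proof -
    have "c * norm r - B \<le> (\<Sum>i\<in>UNIV. \<Sum>j\<in>UNIV. W $ i $ j * \<bar>r $ i - r $ j\<bar>) - B"
      using c that by (simp add: V_def)
    also have "\<dots> = (\<Sum>i\<in>UNIV. \<Sum>j\<in>UNIV. Q $ i $ j * (a i j * \<bar>r $ i - r $ j\<bar> - C i j))"
      by (simp add: B_def W_def sum_subtractf algebra_simps)
    also have "\<dots> \<le> (\<Sum>i\<in>UNIV. \<Sum>j\<in>UNIV.
        Q $ i $ j * ((\<sigma> (r $ i - r $ j) - P $ i $ j) * (r $ i - r $ j)))"
      by (intro sum_mono mult_left_mono aC nonneg)
    also have "\<dots> = residual \<sigma> P Q r \<bullet> comb_grad r"
      by (simp add: inner_vec_def residual_nth comb_grad_def mult.assoc)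
    also have "\<dots> = 2 * real CARD('m) * (\<Phi> r \<bullet> r)"
      by (simp add: \<Phi>_def inner_comb_div[OF transpose_residual[OF assms(1-3)]])
    finally show ?thesis .
  qed
  define R where "R = (\<bar>B\<bar> + 1) / c"
  have "\<exists>r\<in>V. \<Phi> r = 0"
  proof (rule coercive_field_has_zero)
    show "subspace V"
      by (auto simp: V_def subspace_def sum.distrib sum_distrib_left[symmetric])
    have "continuous_on UNIV \<sigma>"
      using assms(1) by (simp add: sigmoid_def)
    then have *: "continuous_on V (\<lambda>r. \<sigma> (r $ i - r $ j))" for i j
      by (rule continuous_on_compose2) (auto intro!: continuous_intros)
    show "continuous_on V \<Phi>"
      unfolding \<Phi>_def comb_div_def residual_nth by (intro continuous_intros *)
    show "\<Phi> r \<in> V" for r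
      unfolding V_def \<Phi>_def
      using sum_comb_div_antisymmetric[OF transpose_residual[OF assms(1-3)]] by simp
    show "R > 0"
      using \<open>c > 0\<close> by (simp add: R_def)
    show "\<Phi> r \<bullet> r \<ge> 0" if "r \<in> V" "norm r = R" for r
    proof -
      have "c * norm r = \<bar>B\<bar> + 1"
        using that \<open>c > 0\<close> by (simp add: R_def)
      then have "0 \<le> 2 * real CARD('m) * (\<Phi> r \<bullet> r)"
        using lower[OF that(1)] by linarith
      then show ?thesis
        by (simp add: zero_le_mult_iff)
    qed
  qed
  then show ?thesis
    by (auto simp: V_def \<Phi>_def)
qed

lemma residual_add_locally_constant:
  fixes P Q :: "real^'m^'m"
  assumes "selection_matrix Q" and "\<And>i j. Q $ i $ j > 0 \<Longrightarrow> x $ i = x $ j"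
  shows "residual \<sigma> P Q (r + x) = residual \<sigma> P Q r"
proof -
  have "residual \<sigma> P Q (r + x) $ i $ j = residual \<sigma> P Q r $ i $ j" for i j
  proof (cases "Q $ i $ j > 0")
    case True
    then show ?thesis
      using assms(2) by (simp add: residual_nth)
  next
    case False
    moreover have "Q $ i $ j \<ge> 0"
      using assms(1) by (simp add: selection_matrix_def)
    ultimately show ?thesis
      by (simp add: residual_nth)
  qed
  then show ?thesis
    by (simp add: vec_eq_iff)
qed

theorem theorem5p1:
  fixes \<sigma> :: "real \<Rightarrow> real" and P Q :: "real^'m^'m"
  assumes "CARD('m) \<ge> 2"
    and "sigmoid \<sigma>"
    and "payoff_matrix P"
    and "selection_matrix Q"
  shows "(\<exists>!r :: real^'m. (\<Sum>i\<in>UNIV. r $ i) = 0 \<and>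
            comb_div (Q \<odot> P) = comb_div (Q \<odot> map_matrix_entries \<sigma> (comb_grad r)))
         \<longleftrightarrow> one_connected_component Q"
  unfolding equation_iff_residual
proof
  assume unique: "\<exists>!r :: real^'m. (\<Sum>i\<in>UNIV. r $ i) = 0 \<and> comb_div (residual \<sigma> P Q r) = 0"
  then obtain r :: "real^'m"
    where r: "(\<Sum>i\<in>UNIV. r $ i) = 0" "comb_div (residual \<sigma> P Q r) = 0"
      and only: "\<forall>s :: real^'m. (\<Sum>i\<in>UNIV. s $ i) = 0 \<and>
                   comb_div (residual \<sigma> P Q s) = 0 \<longrightarrow> s = r"
    unfolding Ex1_def by (elim exE conjE)
  show "one_connected_component Q"
    unfolding one_connected_component_iff
  proof (intro allI impI)
    fix x :: "real^'m" and i j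
    assume x: "\<forall>i j. Q $ i $ j > 0 \<longrightarrow> x $ i = x $ j"
    \<comment> \<open>Subtracting the mean from \<open>x\<close> keeps \<open>r + y\<close> in the hyperplane of sum zero.\<close>
    define y where "y = (\<chi> k. x $ k - (\<Sum>l\<in>UNIV. x $ l) / real CARD('m))"
    have "(\<Sum>k\<in>UNIV. (r + y) $ k) = 0"
      using r(1) by (simp add: y_def sum.distrib sum_subtractf)
    moreover have "residual \<sigma> P Q (r + y) = residual \<sigma> P Q r"
      using x by (intro residual_add_locally_constant assms(4)) (auto simp: y_def)
    ultimately have "r + y = r"
      using r(2) by (intro only[rule_format] conjI) simp_all
    then have "y $ i = y $ j"
      by simp
    then show "x $ i = x $ j"
      by (simp add: y_def)
  qed
next
  assume conn: "one_connected_component Q"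
  show "\<exists>!r :: real^'m. (\<Sum>i\<in>UNIV. r $ i) = 0 \<and> comb_div (residual \<sigma> P Q r) = 0"
  proof (rule ex_ex1I)
    show "\<exists>r :: real^'m. (\<Sum>i\<in>UNIV. r $ i) = 0 \<and> comb_div (residual \<sigma> P Q r) = 0"
      using solution_exists[OF assms(2-4) conn] .
  next
    fix r s :: "real^'m"
    assume r: "(\<Sum>i\<in>UNIV. r $ i) = 0 \<and> comb_div (residual \<sigma> P Q r) = 0"
      and s: "(\<Sum>i\<in>UNIV. s $ i) = 0 \<and> comb_div (residual \<sigma> P Q s) = 0"
    have "\<forall>i j. Q $ i $ j > 0 \<longrightarrow> (r - s) $ i = (r - s) $ j"
      using solutions_differ_by_locally_constant[OF assms(2-4)] r s by blast
    with conn have const: "(r - s) $ i = (r - s) $ j" for i j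
      unfolding one_connected_component_iff by blast
    have "r - s = 0"
      using r s by (intro constant_sum_zero_imp_zero[OF const]) (simp add: sum_subtractf)
    then show "r = s"
      by simp
  qed
qed

end
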